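(* Let $K$ be a commutative field, let $F\subset\mathbb{P}_3(K)$ be the Cayley surface $F=\mathcal{V}(X_0X_1X_2-X_1^3-X_0^2X_3)$, let $g_\infty=\mathcal{V}(X_0,X_1)$, let $\mathcal{L}$ be the set of lines of $\mathbb{P}_3(K)$, and let $$\mathcal{O}:=\{t\in\mathcal{L}\mid t\text{ is a proper osculating tangent of }F\}\cup\{g_\infty\}.$$ Then: (a) $\mathcal{O}$ is a partial spread of $\mathbb{P}_3(K)$ if, and only if, $\operatorname{Char}K\neq 3$ and $K$ does not contain a third root of unity other than $1$. (b) If $\mathcal{O}$ is a partial spread, then it is maximal, i.e., it is not a proper subset of any partial spread of $\mathbb{P}_3(K)$. (c) $\mathcal{O}$ is a covering of $\mathbb{P}_3(K)$ if, and only if, $\operatorname{Char}K\neq 3$ and each element of $K$ has a third root in $K$.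
   Context: Points of the three-dimensional projective space $\mathbb{P}_3(K)$ are the one-dimensional subspaces $K\mathbf{p}$ with $0\neq\mathbf{p}=(p_0,p_1,p_2,p_3)^{T}\in K^{4\times1}$. For homogeneous polynomials $g_1,\dots,g_r\in K[X_0,X_1,X_2,X_3]$, $\mathcal{V}(g_1,\dots,g_r)$ denotes the set of points $K\mathbf{p}$ of $\mathbb{P}_3(K)$ with $g_1(\mathbf{p})=\dots=g_r(\mathbf{p})=0$. Put $f:=X_0X_1X_2-X_1^3-X_0^2X_3$, so $F=\mathcal{V}(f)$. A point of $F$ is simple if not all the partial derivatives $\partial f/\partial X_i$ vanish there. The simple points of $F$ are exactly the points of $F$ outside the plane $\omega=\mathcal{V}(X_0)$, namely $P(u_1,u_2)=K(1,u_1,u_2,u_1u_2-u_1^3)^T$ with $(u_1,u_2)\in K^2$. A generator of $F$ is one of the lines spanned by $K(s_0^2,s_0s_1,s_1^2,0)^T$ and $K(0,0,s_0,s_1)^T$, with $(s_0,s_1)\in K^2\setminus\{(0,0)\}$; these are the lines contained in $F$. A line $t$ is an osculating tangent of $F$ at a simple point $P=K\mathbf{p}$ if it meets $F$ at $P$ with multiplicity $\geq 3$: for $t=K\mathbf{p}+K\mathbf{q}$ the polynomial $f(\mathbf{p}+T\mathbf{q})\in K[T]$ is divisible by $T^3$ (possibly zero). A proper osculating tangent of $F$ is an osculating tangent at some simple point that is not a generator of $F$. A partial spread of $\mathbb{P}_3(K)$ is a set of mutually skew (disjoint) lines. A set of lines is a covering of $\mathbb{P}_3(K)$ if every point of $\mathbb{P}_3(K)$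 is incident with at least one line of the set. A third root of $a\in K$ is an element $b\in K$ with $b^3=a$; a third root of unity is a $w$ with $w^3=1$. *)

theory Defs
  imports "HOL-Analysis.Analysis" "HOL-Library.Poly_Mapping"
begin

section \<open>Multivariate polynomials\<close>

text \<open>A polynomial is a finitely supported map from exponent vectors to coefficients;
  multiplication is the convolution product of \<^theory>\<open>HOL-Library.Poly_Mapping\<close>.\<close>

type_synonym ('i, 'a) mpoly = "('i \<Rightarrow>\<^sub>0 nat) \<Rightarrow>\<^sub>0 'a"

definition Var :: "'i \<Rightarrow> ('i, 'a::comm_ring_1) mpoly"
  where "Var i = Poly_Mapping.single (Poly_Mapping.single i 1) 1"

text \<open>The coefficient embedding \<open>h\<close> allows substituting elements of an extension ring,
  such as \<open>K[T]\<close>.\<close>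

definition eval_with :: "('a::comm_ring_1 \<Rightarrow> 'b::comm_ring_1) \<Rightarrow> 'b ^ 'i \<Rightarrow> ('i::finite, 'a) mpoly \<Rightarrow> 'b"
  where "eval_with h x g =
    (\<Sum>m\<in>Poly_Mapping.keys g.
       h (Poly_Mapping.lookup g m) * (\<Prod>i\<in>UNIV. (x $ i) ^ Poly_Mapping.lookup m i))"

abbreviation eval_mpoly :: "'a::comm_ring_1 ^ 'i \<Rightarrow> ('i::finite, 'a) mpoly \<Rightarrow> 'a"
  where "eval_mpoly \<equiv> eval_with (\<lambda>c. c)"

definition partial_deriv :: "'i \<Rightarrow> ('i, 'a::comm_ring_1) mpoly \<Rightarrow> ('i, 'a) mpoly"
  where "partial_deriv i g =
    (\<Sum>m\<in>Poly_Mapping.keys g.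
       Poly_Mapping.single (m - Poly_Mapping.single i 1)
         (of_nat (Poly_Mapping.lookup m i) * Poly_Mapping.lookup g m))"

section \<open>Points and lines of the three-dimensional projective space\<close>

text \<open>The four coordinates are indexed by \<open>0, 1, 2, 3\<close> in the type \<open>4\<close>.
  (The library calls the index \<open>0\<close> also \<open>4\<close>, so that its function \<open>vector\<close> would put
  the coordinates in a different order.)
  Points are one-dimensional subspaces of \<open>K\<^sup>4\<close>; lines are sets of points, so that
  \<open>V(X\<^sub>0, X\<^sub>1)\<close> is a line and skew lines are disjoint sets.\<close>

definition vec4 :: "'a \<Rightarrow> 'a \<Rightarrow> 'a \<Rightarrow> 'a \<Rightarrow> 'a ^ 4"
  where "vec4 a b c d = (\<chi> i. if i = 0 then a else if i = 1 then b else if i = 2 then c else d)"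

definition points :: "('a::field ^ 4) set set"
  where "points = {vec.span {p} | p. p \<noteq> 0}"

definition pts_of :: "('a::field ^ 4) set \<Rightarrow> ('a ^ 4) set set"
  where "pts_of U = {P \<in> points. P \<subseteq> U}"

definition lines :: "('a::field ^ 4) set set set"
  where "lines = {pts_of U | U. vec.subspace U \<and> vec.dim U = 2}"

definition zero_set :: "(4, 'a::field) mpoly set \<Rightarrow> ('a ^ 4) set set"
  where "zero_set G = {vec.span {p} | p. p \<noteq> 0 \<and> (\<forall>g\<in>G. eval_mpoly p g = 0)}"

definition partial_spread :: "('a::field ^ 4) set set set \<Rightarrow> bool"
  where "partial_spread S \<longleftrightarrow> S \<subseteq> lines \<and> (\<forall>l\<in>S. \<forall>m\<in>S. l \<noteq> m \<longrightarrow> l \<inter> m = {})"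

definition covering :: "('a::field ^ 4) set set set \<Rightarrow> bool"
  where "covering S \<longleftrightarrow> S \<subseteq> lines \<and> (\<forall>P\<in>points. \<exists>l\<in>S. P \<in> l)"

section \<open>The Cayley surface and its osculating tangents\<close>

definition cayley :: "(4, 'a::field) mpoly"
  where "cayley = Var 0 * Var 1 * Var 2 - Var 1 ^ 3 - Var 0 ^ 2 * Var 3"

definition cayley_surface :: "('a::field ^ 4) set set"
  where "cayley_surface = zero_set {cayley}"

definition g_infinity :: "('a::field ^ 4) set set"
  where "g_infinity = zero_set {Var 0, Var 1}"

definition simple_point :: "('a::field ^ 4) set \<Rightarrow> bool"
  where "simple_point P \<longleftrightarrow> P \<in> cayley_surface \<and>
    (\<exists>p. p \<noteq> 0 \<and> P = vec.span {p} \<and> (\<exists>i. eval_mpoly p (partial_deriv i cayley) \<noteq> 0))"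

definition generator :: "('a::field ^ 4) set set \<Rightarrow> bool"
  where "generator t \<longleftrightarrow> (\<exists>s0 s1. (s0, s1) \<noteq> (0, 0) \<and>
    t = pts_of (vec.span {vec4 (s0\<^sup>2) (s0 * s1) (s1\<^sup>2) 0, vec4 0 0 s0 s1}))"

text \<open>The argument of \<^const>\<open>eval_with\<close> is the vector \<open>p + T q\<close> over \<open>K[T]\<close>.\<close>

definition osculating_tangent_at :: "('a::field ^ 4) set set \<Rightarrow> ('a ^ 4) set \<Rightarrow> bool"
  where "osculating_tangent_at t P \<longleftrightarrow> simple_point P \<and> t \<in> lines \<and>
    (\<exists>p q. p \<noteq> 0 \<and> P = vec.span {p} \<and> t = pts_of (vec.span {p, q}) \<and>
       [:0, 1:] ^ 3 dvd eval_with (\<lambda>c. [:c:]) (\<chi> i. [:p $ i, q $ i:]) cayley)"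

definition proper_osculating_tangent :: "('a::field ^ 4) set set \<Rightarrow> bool"
  where "proper_osculating_tangent t \<longleftrightarrow> (\<exists>P. osculating_tangent_at t P) \<and> \<not> generator t"

end

theory Submission
  imports Defs
begin

text \<open>
  At the point \<open>(1, u, v, uv - u\<^sup>3)\<close> the condition that a direction with first coordinate \<open>0\<close> is
  osculating factors: one solution is the generator, the other the line through \<open>(0, 1, 3u, v)\<close>.
  An affine point \<open>(1, x, y, z)\<close> lies on the osculating line with parameters \<open>u, v\<close> iff \<open>v\<close> is a
  certain polynomial in \<open>u, x, y\<close> and \<open>(u - x)\<^sup>3\<close> is the value of the cubic form at the point; a
  point \<open>(0, 1, y, z)\<close> lies on it iff \<open>y = 3u\<close> and \<open>z = v\<close>.  So uniqueness and existence of a line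
  through each point come down to injectivity and surjectivity of cubing and of multiplication by \<open>3\<close>.
\<close>

section \<open>Evaluating the Cayley cubic\<close>

text \<open>The three key sets may differ, so all sums are extended to the union of the keys of
  \<open>p\<close> and \<open>q\<close>, where the extra terms vanish by
  \<open>\<phi> k 0 = 0\<close>. This serves evaluation and differentiation alike.\<close>

lemma sum_keys_diff:
  assumes "\<And>k. \<phi> k 0 = (0::'b::ab_group_add)" "\<And>k a b. \<phi> k (a - b) = \<phi> k a - \<phi> k b"
  shows "(\<Sum>k\<in>Poly_Mapping.keys (p - q). \<phi> k (Poly_Mapping.lookup (p - q) k)) =
    (\<Sum>k\<in>Poly_Mapping.keys p. \<phi> k (Poly_Mapping.lookup p k)) -
    (\<Sum>k\<in>Poly_Mapping.keys (q :: 'i \<Rightarrow>\<^sub>0 'a::ab_group_add). \<phi> k (Poly_Mapping.lookup q k))"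
proof -
  let ?A = "Poly_Mapping.keys p \<union> Poly_Mapping.keys q"
  have *: "(\<Sum>k\<in>Poly_Mapping.keys r. \<phi> k (Poly_Mapping.lookup r k)) =
      (\<Sum>k\<in>?A. \<phi> k (Poly_Mapping.lookup r k))" if "Poly_Mapping.keys r \<subseteq> ?A" for r
    by (rule sum.mono_neutral_left) (use that assms(1) in \<open>auto simp: in_keys_iff\<close>)
  have "Poly_Mapping.keys (p - q) \<subseteq> ?A"
    by (auto simp: in_keys_iff lookup_minus)
  from *[OF this] *[of p] *[of q] show ?thesis
    by (simp add: assms(2) lookup_minus sum_subtractf)
qed

lemma eval_with_diff:
  assumes "h 0 = 0" "\<And>a b. h (a - b) = h a - h b"
  shows "eval_with h x (f - g) = eval_with h x f - eval_with h x g"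
  unfolding eval_with_def by (rule sum_keys_diff) (simp_all add: assms algebra_simps)

lemma eval_with_uminus:
  assumes "h 0 = 0" "\<And>a b. h (a - b) = h a - h b"
  shows "eval_with h x (- f) = - eval_with h x f"
  using eval_with_diff[OF assms, of x 0 f] by (simp add: eval_with_def)

lemma eval_with_single:
  assumes "h 0 = 0"
  shows "eval_with h x (Poly_Mapping.single m c) =
    h c * (\<Prod>i\<in>UNIV. (x $ i) ^ Poly_Mapping.lookup m i)"
  by (cases "c = 0") (simp_all add: eval_with_def assms)

lemma partial_deriv_diff:
  "partial_deriv i (f - g) = partial_deriv i f - partial_deriv i g"
  unfolding partial_deriv_def
  by (rule sum_keys_diff) (simp_all add: algebra_simps single_diff)

lemma partial_deriv_single:
  "partial_deriv i (Poly_Mapping.single m c) =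
    Poly_Mapping.single (m - Poly_Mapping.single i 1) (of_nat (Poly_Mapping.lookup m i) * c)"
  by (cases "c = 0") (simp_all add: partial_deriv_def)

lemma Var_power: "Var i ^ n = Poly_Mapping.single (Poly_Mapping.single i n) 1"
  by (induction n) (simp_all add: Var_def mult_single flip: single_add)

text \<open>\<open>UNIV_4\<close> lists the index 0 as 4; rewriting it lets the coordinates be
  enumerated from 0.\<close>

lemma four_eq_zero: "(4::4) = 0"
  by simp

lemma UNIV_4_from_0: "UNIV = {0, 1, 2, 3 :: 4}"
  unfolding UNIV_4 four_eq_zero by blast

lemma prod_4_from_0: "prod f UNIV = f 0 * f 1 * f 2 * f (3 :: 4)"
  unfolding UNIV_4_from_0 by (simp add: mult.assoc)

text \<open>As a difference of monomials the cubic can be evaluated and differentiated term by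
  term.\<close>

lemma cayley_eq_singles:
  "cayley = Poly_Mapping.single (Poly_Mapping.single 0 1 + Poly_Mapping.single 1 1 + Poly_Mapping.single 2 1) 1
    - Poly_Mapping.single (Poly_Mapping.single 1 3) 1
    - Poly_Mapping.single (Poly_Mapping.single 0 2 + Poly_Mapping.single 3 1) 1"
  unfolding cayley_def Var_power by (simp add: Var_def mult_single)

text \<open>The coefficients are 1 and -1, so these properties of \<open>h\<close> suffice. They
  hold for the identity and for the embedding of constants into \<open>K[T]\<close>.\<close>

lemma eval_with_cayley:
  assumes "h 0 = 0" "h 1 = 1" "\<And>a b. h (a - b) = h a - h b"
  shows "eval_with h x cayley = x $ 0 * x $ 1 * x $ 2 - (x $ 1) ^ 3 - (x $ 0)\<^sup>2 * x $ 3"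
  unfolding cayley_eq_singles
  \<comment> \<open>The index 0 is also the zero of the key type, so \<open>single_numeral\<close>
    would turn the exponent vector \<open>single 0 2\<close> into a numeral.\<close>
  by (simp add: eval_with_diff eval_with_single assms prod_4_from_0 lookup_add lookup_single when_def
      del: single_numeral)

lemma eval_partial_deriv_cayley:
  fixes x :: "'a::field ^ 4"
  shows "eval_mpoly x (partial_deriv 0 cayley) = x $ 1 * x $ 2 - 2 * x $ 0 * x $ 3"
    and "eval_mpoly x (partial_deriv 1 cayley) = x $ 0 * x $ 2 - 3 * (x $ 1)\<^sup>2"
    and "eval_mpoly x (partial_deriv 2 cayley) = x $ 0 * x $ 1"
    and "eval_mpoly x (partial_deriv 3 cayley) = - (x $ 0)\<^sup>2"
  unfolding cayley_eq_singles partial_deriv_diff partial_deriv_single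
  by (simp_all add: eval_with_diff eval_with_uminus eval_with_single prod_4_from_0 lookup_add lookup_minus
      lookup_single when_def del: single_numeral)

section \<open>Points and lines\<close>

lemma vec4_nth [simp]:
  "vec4 a b c d $ 0 = a" "vec4 a b c d $ 1 = b" "vec4 a b c d $ 2 = c" "vec4 a b c d $ 3 = d"
  by (simp_all add: vec4_def)

lemma vec4_eq_iff: "x = y \<longleftrightarrow> x $ 0 = y $ 0 \<and> x $ 1 = y $ 1 \<and> x $ 2 = y $ 2 \<and> x $ 3 = (y :: 'a ^ 4) $ 3"
proof -
  have "x = y \<longleftrightarrow> (\<forall>i\<in>UNIV. x $ i = y $ i)" by (simp add: vec_eq_iff)
  then show ?thesis unfolding UNIV_4_from_0 by simp
qed

lemma in_span_pair: "x \<in> vec.span {p, q} \<longleftrightarrow> (\<exists>a b. x = a *s p + b *s (q :: 'a::field ^ 'n))"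
proof -
  have "x \<in> vec.span {p, q} \<longleftrightarrow> (\<exists>a b. x - a *s p = b *s q)"
    by (auto simp: vec.span_breakdown_eq[of x] vec.span_singleton)
  then show ?thesis by (simp add: diff_eq_eq add.commute)
qed

lemma span_in_pts_of: "x \<noteq> 0 \<Longrightarrow> vec.subspace U \<Longrightarrow> vec.span {x} \<in> pts_of U \<longleftrightarrow> x \<in> U"
  using vec.span_base[of x "{x}"] vec.span_minimal[of "{x}" U]
  unfolding pts_of_def points_def by auto

lemma pts_of_inject:
  assumes "vec.subspace U" "vec.subspace W" "pts_of U = pts_of W"
  shows "U = W"
proof -
  have "x \<in> U \<longleftrightarrow> x \<in> W" for x
    using assms span_in_pts_of[of x U] span_in_pts_of[of x W] vec.subspace_0
    by (cases "x = 0") auto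
  then show ?thesis by blast
qed

lemma dim_span_pair_le: "vec.dim (vec.span {p, q :: 'a::field ^ 'n}) \<le> 2"
proof -
  have "vec.dim (vec.span {p, q}) \<le> card {p, q}"
    unfolding vec.dim_span by (rule vec.dim_le_card') simp
  also have "\<dots> \<le> 2" by (simp add: card_insert_if)
  finally show ?thesis .
qed

text \<open>Being a line forces dimension 2 on the left, and the right side has dimension at most 2,
  so inclusion is equality.\<close>

lemma line_eq_of_mem:
  assumes "pts_of (vec.span {p, q}) \<in> lines" "p \<in> vec.span {a, b}" "q \<in> vec.span {a, b}"
  shows "vec.span {p, q} = vec.span {a, b}"
proof -
  obtain U where U: "pts_of (vec.span {p, q}) = pts_of U" "vec.subspace U" "vec.dim U = 2"
    using assms(1) by (auto simp: lines_def)
  then have "vec.dim (vec.span {p, q}) = 2"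
    using pts_of_inject[of "vec.span {p, q}" U] by auto
  moreover have "vec.span {p, q} \<subseteq> vec.span {a, b}"
    using assms(2,3) by (intro vec.span_minimal) auto
  ultimately show ?thesis
    using dim_span_pair_le[of a b] by (intro vec.subspace_dim_equal) auto
qed

lemma pts_of_span_pair_in_lines:
  assumes "\<And>a b. a *s p + b *s q = 0 \<Longrightarrow> a = 0 \<and> b = 0"
  shows "pts_of (vec.span {p, q :: 'a::field ^ 4}) \<in> lines"
proof -
  have "q \<noteq> 0" using assms[of 0 1] by auto
  have "p \<noteq> k *s q" for k
    using assms[of 1 "-k"] by auto
  then have p: "p \<notin> vec.span {q}" by (auto simp: vec.span_singleton)
  then have "p \<noteq> q" using vec.span_base[of q "{q}"] by auto
  have "vec.independent {p, q}"
    using p \<open>q \<noteq> 0\<close> by (simp add: vec.independent_insert)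
  then have "vec.dim (vec.span {p, q}) = 2"
    using \<open>p \<noteq> q\<close> by (simp add: vec.dim_eq_card_independent)
  then show ?thesis unfolding lines_def by blast
qed

lemma line_meets_plane:
  assumes "l \<in> (lines :: ('a::field ^ 4) set set set)"
  obtains x where "x \<noteq> 0" "x $ 0 = 0" "vec.span {x} \<in> l"
proof -
  obtain U where U: "l = pts_of U" "vec.subspace U" "vec.dim U = 2"
    using assms by (auto simp: lines_def)
  obtain B where B: "B \<subseteq> U" "vec.independent B" "card B = 2"
    using vec.basis_exists[of U] U(3) by metis
  obtain p q where pq: "B = {p, q}" "p \<noteq> q" using B(3) by (auto simp: card_2_iff)
  have "q \<noteq> 0" "p \<notin> vec.span {q}"
    using B(2) pq vec.dependent_zero[of B] by (auto simp: vec.independent_insert)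
  have "\<exists>x. x \<noteq> 0 \<and> x $ 0 = 0 \<and> x \<in> U"
  proof (cases "q $ 0 = 0")
    case True
    then show ?thesis using \<open>q \<noteq> 0\<close> B(1) pq by auto
  next
    case False
    \<comment> \<open>Eliminates the coordinate 0; the result is nonzero since \<open>p\<close> is
      no multiple of \<open>q\<close>.\<close>
    let ?x = "p - (p $ 0 / q $ 0) *s q"
    have "?x \<noteq> 0" using \<open>p \<notin> vec.span {q}\<close> by (auto simp: vec.span_singleton)
    moreover have "?x $ 0 = 0" using False by simp
    moreover have "?x \<in> U"
      using B(1) pq U(2) by (intro vec.subspace_diff vec.subspace_scale) auto
    ultimately show ?thesis by blast
  qed
  then show thesis using that U span_in_pts_of by metis
qed

section \<open>Osculating tangents\<close>

definition osc_line :: "'a::field \<Rightarrow> 'a \<Rightarrow> ('a ^ 4) set set"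
  where "osc_line u v = pts_of (vec.span {vec4 1 u v (u * v - u ^ 3), vec4 0 1 (3 * u) v})"

text \<open>The coordinates 0 and 1 fix the coefficients as \<open>x $ 0\<close> and
  \<open>x $ 1 - u * x $ 0\<close>; the other two coordinates then give the equations of the
  line.\<close>

lemma in_span_osc_line:
  "x \<in> vec.span {vec4 1 u v (u * v - u ^ 3), vec4 0 1 (3 * u) v} \<longleftrightarrow>
    x $ 2 = (v - 3 * u\<^sup>2) * x $ 0 + 3 * u * x $ 1 \<and> x $ 3 = v * x $ 1 - u ^ 3 * x $ 0"
    (is "_ \<longleftrightarrow> ?R")
proof
  assume ?R
  then have "x = x $ 0 *s vec4 1 u v (u * v - u ^ 3) + (x $ 1 - u * x $ 0) *s vec4 0 1 (3 * u) v"
    by (simp add: vec4_eq_iff algebra_simps power2_eq_square)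
  then show "x \<in> vec.span {vec4 1 u v (u * v - u ^ 3), vec4 0 1 (3 * u) v}"
    unfolding in_span_pair by blast
qed (auto simp: in_span_pair algebra_simps power2_eq_square)

lemma in_osc_line:
  assumes "x \<noteq> 0"
  shows "vec.span {x} \<in> osc_line u v \<longleftrightarrow>
    x $ 2 = (v - 3 * u\<^sup>2) * x $ 0 + 3 * u * x $ 1 \<and> x $ 3 = v * x $ 1 - u ^ 3 * x $ 0"
  using assms by (simp add: osc_line_def span_in_pts_of in_span_osc_line)

lemma osc_line_in_lines: "osc_line u v \<in> lines"
  unfolding osc_line_def
  by (rule pts_of_span_pair_in_lines) (auto simp: vec4_eq_iff)

section \<open>Points of the surface and its simple points\<close>

lemma span_singleton_eq_imp_scaled:
  assumes "vec.span {p} = vec.span {q}" "p \<noteq> (0 :: 'a::field ^ 'n)"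
  obtains c where "c \<noteq> 0" "p = c *s q"
proof -
  have "p \<in> vec.span {q}" using assms(1) vec.span_base[of p "{p}"] by auto
  then obtain c where "p = c *s q" by (auto simp: vec.span_singleton)
  then show thesis using that assms(2) by (cases "c = 0") auto
qed

text \<open>The cubic is homogeneous of degree 3, so its vanishing does not depend on the
  representative.\<close>

lemma in_zero_set_cayley:
  assumes "p \<noteq> (0 :: 'a::field ^ 4)"
  shows "vec.span {p} \<in> cayley_surface \<longleftrightarrow> p $ 0 * p $ 1 * p $ 2 - (p $ 1) ^ 3 - (p $ 0)\<^sup>2 * p $ 3 = 0"
proof
  assume "vec.span {p} \<in> cayley_surface"
  then obtain r where r: "vec.span {p} = vec.span {r}"
      "r $ 0 * r $ 1 * r $ 2 - (r $ 1) ^ 3 - (r $ 0)\<^sup>2 * r $ 3 = 0"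
    unfolding cayley_surface_def zero_set_def by (auto simp: eval_with_cayley)
  then obtain c where c: "p = c *s r" using assms span_singleton_eq_imp_scaled by metis
  have "p $ 0 * p $ 1 * p $ 2 - (p $ 1) ^ 3 - (p $ 0)\<^sup>2 * p $ 3 =
      c ^ 3 * (r $ 0 * r $ 1 * r $ 2 - (r $ 1) ^ 3 - (r $ 0)\<^sup>2 * r $ 3)"
    unfolding c by (simp add: algebra_simps power2_eq_square power3_eq_cube)
  then show "p $ 0 * p $ 1 * p $ 2 - (p $ 1) ^ 3 - (p $ 0)\<^sup>2 * p $ 3 = 0" using r(2) by simp
next
  assume "p $ 0 * p $ 1 * p $ 2 - (p $ 1) ^ 3 - (p $ 0)\<^sup>2 * p $ 3 = 0"
  then show "vec.span {p} \<in> cayley_surface"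
    using assms unfolding cayley_surface_def zero_set_def by (auto simp: eval_with_cayley)
qed

text \<open>On the surface, \<open>p $ 0 = 0\<close> forces \<open>p $ 1 = 0\<close>, and then all
  partial derivatives vanish; otherwise the last one, minus the square of \<open>p $ 0\<close>, is
  nonzero.\<close>

lemma simple_point_iff:
  assumes "p \<noteq> (0 :: 'a::field ^ 4)"
  shows "simple_point (vec.span {p}) \<longleftrightarrow>
    p $ 0 \<noteq> 0 \<and> p $ 0 * p $ 1 * p $ 2 - (p $ 1) ^ 3 - (p $ 0)\<^sup>2 * p $ 3 = 0"
proof
  assume simp: "simple_point (vec.span {p})"
  then have F: "p $ 0 * p $ 1 * p $ 2 - (p $ 1) ^ 3 - (p $ 0)\<^sup>2 * p $ 3 = 0"
    using in_zero_set_cayley[OF assms] by (simp add: simple_point_def)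
  obtain r i where r: "r \<noteq> 0" "vec.span {r} = vec.span {p}"
      and i: "eval_mpoly r (partial_deriv i cayley) \<noteq> 0"
    using simp unfolding simple_point_def by metis
  obtain c where c: "r = c *s p" using span_singleton_eq_imp_scaled[OF r(2,1)] by metis
  have "p $ 0 \<noteq> 0"
  proof
    assume "p $ 0 = 0"
    then have "r $ 0 = 0" "r $ 1 = 0" using F c by auto
    then have "\<forall>i\<in>{0, 1, 2, 3}. eval_mpoly r (partial_deriv i cayley) = 0"
      by (simp add: eval_partial_deriv_cayley)
    then show False using i unfolding UNIV_4_from_0[symmetric] by blast
  qed
  with F show "p $ 0 \<noteq> 0 \<and> p $ 0 * p $ 1 * p $ 2 - (p $ 1) ^ 3 - (p $ 0)\<^sup>2 * p $ 3 = 0" by simp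
next
  assume R: "p $ 0 \<noteq> 0 \<and> p $ 0 * p $ 1 * p $ 2 - (p $ 1) ^ 3 - (p $ 0)\<^sup>2 * p $ 3 = 0"
  then have "eval_mpoly p (partial_deriv 3 cayley) \<noteq> 0" by (simp add: eval_partial_deriv_cayley)
  then show "simple_point (vec.span {p})"
    using R assms in_zero_set_cayley[OF assms] unfolding simple_point_def by metis
qed

text \<open>Taylor expansion of a cubic form \<open>f\<close>: the coefficients are
  \<open>f(p)\<close>, the gradient at \<open>p\<close> applied to \<open>q\<close>, the gradient at
  \<open>q\<close> applied to \<open>p\<close>, and \<open>f(q)\<close>.\<close>

lemma eval_cayley_pencil:
  fixes p q :: "'a::field ^ 4"
  shows "eval_with (\<lambda>c. [:c:]) (\<chi> i. [:p $ i, q $ i:]) cayley =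
    [:p $ 0 * p $ 1 * p $ 2 - (p $ 1) ^ 3 - (p $ 0)\<^sup>2 * p $ 3,
      q $ 0 * (p $ 1 * p $ 2 - 2 * p $ 0 * p $ 3) + q $ 1 * (p $ 0 * p $ 2 - 3 * (p $ 1)\<^sup>2)
        + q $ 2 * p $ 0 * p $ 1 - q $ 3 * (p $ 0)\<^sup>2,
      p $ 0 * q $ 1 * q $ 2 + p $ 1 * q $ 0 * q $ 2 + p $ 2 * q $ 0 * q $ 1
        - 3 * p $ 1 * (q $ 1)\<^sup>2 - 2 * p $ 0 * q $ 0 * q $ 3 - (q $ 0)\<^sup>2 * p $ 3,
      q $ 0 * q $ 1 * q $ 2 - (q $ 1) ^ 3 - (q $ 0)\<^sup>2 * q $ 3:]"
  by (subst eval_with_cayley)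
    (simp_all add: one_pCons algebra_simps power2_eq_square power3_eq_cube)

lemma T_cubed_dvd_iff:
  "[:0, 1:] ^ 3 dvd [:a, b, c, d :: 'a::field:] \<longleftrightarrow> a = 0 \<and> b = 0 \<and> c = 0"
proof -
  have "[:0, 1:] ^ 3 = (monom 1 3 :: 'a poly)" by (simp add: monom_altdef)
  then show ?thesis
    by (simp add: monom_1_dvd_iff' numeral_3_eq_3 less_Suc_eq all_conj_distrib coeff_pCons)
qed

section \<open>Classification of the proper osculating tangents\<close>

lemma proper_osculating_tangent_osc_line: "proper_osculating_tangent (osc_line u v)"
proof -
  let ?p = "vec4 1 u v (u * v - u ^ 3)" and ?q = "vec4 0 1 (3 * u) v"
  have p: "?p \<noteq> 0" and q: "?q \<noteq> 0" by (simp_all add: vec4_eq_iff)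
  have "simple_point (vec.span {?p})"
    by (simp add: simple_point_iff[OF p] algebra_simps)
  moreover have "[:0, 1:] ^ 3 dvd eval_with (\<lambda>c. [:c:]) (\<chi> i. [:?p $ i, ?q $ i:]) cayley"
    unfolding eval_cayley_pencil T_cubed_dvd_iff
    by (simp add: algebra_simps power2_eq_square power3_eq_cube)
  ultimately have "osculating_tangent_at (osc_line u v) (vec.span {?p})"
    unfolding osculating_tangent_at_def using p osc_line_in_lines osc_line_def by blast
  moreover have "\<not> generator (osc_line u v)"
  proof
    assume "generator (osc_line u v)"
    then obtain s0 s1 where s: "osc_line u v =
        pts_of (vec.span {vec4 (s0\<^sup>2) (s0 * s1) (s1\<^sup>2) 0, vec4 0 0 s0 s1})"
      by (auto simp: generator_def)
    \<comment> \<open>The points of a generator with \<open>X0 = 0\<close> also have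
      \<open>X1 = 0\<close>, which fails for \<open>?q\<close>.\<close>
    have "vec.span {?q} \<in> osc_line u v" by (simp add: in_osc_line[OF q])
    then have "?q \<in> vec.span {vec4 (s0\<^sup>2) (s0 * s1) (s1\<^sup>2) 0, vec4 0 0 s0 s1}"
      unfolding s using q by (simp add: span_in_pts_of)
    then show False by (auto simp: in_span_pair vec4_eq_iff)
  qed
  ultimately show ?thesis unfolding proper_osculating_tangent_def by blast
qed

lemma proper_osculating_tangent_imp_osc_line:
  assumes "proper_osculating_tangent (t :: ('a::field ^ 4) set set)"
  shows "\<exists>u v. t = osc_line u v"
proof -
  obtain P p q where t: "t \<in> lines" "t = pts_of (vec.span {p, q})" and p: "p \<noteq> 0"
      and P: "simple_point P" "P = vec.span {p}"
      and dvd: "[:0, 1:] ^ 3 dvd eval_with (\<lambda>c. [:c:]) (\<chi> i. [:p $ i, q $ i:]) cayley"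
      and gen: "\<not> generator t"
    using assms unfolding proper_osculating_tangent_def osculating_tangent_at_def by blast
  have p0: "p $ 0 \<noteq> 0" and F: "p $ 0 * p $ 1 * p $ 2 - (p $ 1) ^ 3 - (p $ 0)\<^sup>2 * p $ 3 = 0"
    using P simple_point_iff[OF p] by auto
  define u v where "u = p $ 1 / p $ 0" and "v = p $ 2 / p $ 0"
  have p1: "p $ 1 = p $ 0 * u" and p2: "p $ 2 = p $ 0 * v"
    using p0 by (simp_all add: u_def v_def)
  have "(p $ 0)\<^sup>2 * (p $ 3 - p $ 0 * (u * v - u ^ 3)) = 0"
    using F unfolding p1 p2 by algebra
  then have p3: "p $ 3 = p $ 0 * (u * v - u ^ 3)" using p0 by simp
  \<comment> \<open>The vector \<open>(0, r1, r2, r3)\<close> is \<open>q\<close> minus the multiple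
    of \<open>p\<close> that cancels its coordinate 0; it is the direction of \<open>t\<close> in
    the plane \<open>X0 = 0\<close>.\<close>
  define r1 r2 r3 where "r1 = q $ 1 - u * q $ 0" and "r2 = q $ 2 - v * q $ 0"
    and "r3 = q $ 3 - (u * v - u ^ 3) * q $ 0"
  then have q: "q $ 1 = u * q $ 0 + r1" "q $ 2 = v * q $ 0 + r2"
      "q $ 3 = (u * v - u ^ 3) * q $ 0 + r3"
    by simp_all
  note dvd = dvd[unfolded eval_cayley_pencil T_cubed_dvd_iff p1 p2 p3 q]
  \<comment> \<open>The coefficient of \<open>T\<close>: the direction lies in the tangent plane at
    \<open>P\<close>.\<close>
  have "(p $ 0)\<^sup>2 * (r1 * (v - 3 * u\<^sup>2) + r2 * u - r3) = 0"
    using dvd[THEN conjunct2, THEN conjunct1] by algebra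
  then have L: "r3 = r1 * (v - 3 * u\<^sup>2) + r2 * u" using p0 by simp
  \<comment> \<open>Modulo the tangent plane equation, the coefficient of \<open>T^2\<close> splits
    into two linear factors, one for each osculating direction.\<close>
  have "p $ 0 * (r1 * (r2 - 3 * u * r1)) = 0"
    using dvd[THEN conjunct2, THEN conjunct2] unfolding L by algebra
  then have Q: "r1 = 0 \<or> r2 = 3 * u * r1" using p0 by simp
  have "r1 \<noteq> 0"
  proof
    assume r1: "r1 = 0"
    \<comment> \<open>For \<open>r1 = 0\<close> the direction is a multiple of
      \<open>(0, 0, 1, u)\<close>, so \<open>t\<close> is the generator with parameters
      \<open>(1, u)\<close>.\<close>
    have "p = p $ 0 *s vec4 1 u (u\<^sup>2) 0 + (p $ 0 * (v - u\<^sup>2)) *s vec4 0 0 1 u"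
      by (simp add: vec4_eq_iff p1 p2 p3 algebra_simps power2_eq_square power3_eq_cube)
    moreover have "q = q $ 0 *s vec4 1 u (u\<^sup>2) 0 + (q $ 2 - u\<^sup>2 * q $ 0) *s vec4 0 0 1 u"
      by (simp add: vec4_eq_iff q L r1 algebra_simps power2_eq_square power3_eq_cube)
    ultimately have "t = pts_of (vec.span {vec4 1 u (u\<^sup>2) 0, vec4 0 0 1 u})"
      using t line_eq_of_mem in_span_pair by metis
    then have "generator t"
      unfolding generator_def by (intro exI[of _ 1] exI[of _ u]) simp
    with gen show False by simp
  qed
  \<comment> \<open>Together with \<open>L\<close> this gives \<open>r3 = v * r1\<close>: the
    direction is \<open>r1\<close> times \<open>(0, 1, 3u, v)\<close>.\<close>
  with Q have r2: "r2 = 3 * u * r1" by simp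
  have "p \<in> vec.span {vec4 1 u v (u * v - u ^ 3), vec4 0 1 (3 * u) v}"
    unfolding in_span_osc_line
    by (simp add: p1 p2 p3 algebra_simps power2_eq_square power3_eq_cube)
  moreover have "q \<in> vec.span {vec4 1 u v (u * v - u ^ 3), vec4 0 1 (3 * u) v}"
    unfolding in_span_osc_line
    by (simp add: q L r2 algebra_simps power2_eq_square power3_eq_cube)
  ultimately have "t = osc_line u v"
    using t line_eq_of_mem unfolding osc_line_def by metis
  then show ?thesis by blast
qed

lemma proper_osculating_tangents_eq:
  "{t \<in> lines. proper_osculating_tangent t} = {osc_line u v | u v. True}"
  using proper_osculating_tangent_imp_osc_line proper_osculating_tangent_osc_line
    osc_line_in_lines by blast

section \<open>Incidence of points with the osculating tangents\<close>

lemma span_scaled: "c \<noteq> 0 \<Longrightarrow> vec.span {c *s p} = vec.span {p :: 'a::field ^ 'n}"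
proof -
  assume "c \<noteq> 0"
  then have "p = inverse c *s (c *s p)" by (simp add: vec.scale_scale)
  then have "p \<in> vec.span {c *s p}" by (metis rangeI vec.span_singleton)
  moreover have "c *s p \<in> vec.span {p}" by (simp add: vec.span_base vec.span_scale)
  ultimately show ?thesis by (simp add: vec.span_eq)
qed

lemma point_cases:
  assumes "P \<in> (points :: ('a::field ^ 4) set set)"
  obtains (affine) x y z where "P = vec.span {vec4 1 x y z}"
  | (infinite) y z where "P = vec.span {vec4 0 1 y z}"
  | (on_g_infinity) p where "p \<noteq> 0" "p $ 0 = 0" "p $ 1 = 0" "P = vec.span {p}"
proof -
  obtain p where p: "p \<noteq> 0" "P = vec.span {p}" using assms by (auto simp: points_def)
  consider "p $ 0 \<noteq> 0" | "p $ 0 = 0" "p $ 1 \<noteq> 0" | "p $ 0 = 0" "p $ 1 = 0" by blast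
  then show thesis
  proof cases
    case 1
    have "p = p $ 0 *s vec4 1 (p $ 1 / p $ 0) (p $ 2 / p $ 0) (p $ 3 / p $ 0)"
      using 1 by (simp add: vec4_eq_iff)
    then show thesis using 1 p(2) affine span_scaled by metis
  next
    case 2
    have "p = p $ 1 *s vec4 0 1 (p $ 2 / p $ 1) (p $ 3 / p $ 1)"
      using 2 by (simp add: vec4_eq_iff)
    then show thesis using 2 p(2) infinite span_scaled by metis
  next
    case 3
    then show thesis using p on_g_infinity by blast
  qed
qed

lemma affine_in_osc_line:
  "vec.span {vec4 1 x y z} \<in> osc_line u v \<longleftrightarrow>
    v = y - 3 * u * x + 3 * u\<^sup>2 \<and> (u - x) ^ 3 = x * y - x ^ 3 - z"
proof -
  have "vec4 1 x y z \<noteq> 0" by (simp add: vec4_eq_iff)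
  then have "vec.span {vec4 1 x y z} \<in> osc_line u v \<longleftrightarrow>
      y = v - 3 * u\<^sup>2 + 3 * u * x \<and> z = v * x - u ^ 3"
    by (simp add: in_osc_line)
  also have "\<dots> \<longleftrightarrow> v = y - 3 * u * x + 3 * u\<^sup>2 \<and> z = v * x - u ^ 3"
    by (auto simp: algebra_simps)
  \<comment> \<open>Substituting \<open>v\<close> gives
    \<open>x*y - z = u^3 - 3*u^2*x + 3*u*x^2\<close>; subtracting \<open>x^3\<close> completes the
    cube.\<close>
  also have "\<dots> \<longleftrightarrow> v = y - 3 * u * x + 3 * u\<^sup>2 \<and> (u - x) ^ 3 = x * y - x ^ 3 - z"
    by (intro conj_cong refl) (simp, algebra)
  finally show ?thesis .
qed

lemma infinite_in_osc_line:
  "vec.span {vec4 0 1 y z} \<in> osc_line u v \<longleftrightarrow> y = 3 * u \<and> z = v"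
  by (subst in_osc_line) (simp_all add: vec4_eq_iff)

text \<open>With \<open>X0 = X1 = 0\<close> the equations of the line make the other two coordinates
  vanish as well.\<close>

lemma not_in_osc_line:
  assumes "p \<noteq> 0" "p $ 0 = 0" "p $ 1 = 0"
  shows "vec.span {p} \<notin> osc_line u v"
  using assms by (auto simp: in_osc_line vec4_eq_iff)

text \<open>The contact point of one line lies on the other, so \<open>(u' - u) ^ 3 = 0\<close>.
  Hence a point on lines with different parameters violates skewness.\<close>

lemma osc_line_inject:
  assumes "osc_line u v = osc_line u' v'"
  shows "u = u' \<and> v = v'"
proof -
  have "vec.span {vec4 1 u v (u * v - u ^ 3)} \<in> osc_line u v"
    by (simp add: affine_in_osc_line power2_eq_square)
  then have "v' = v - 3 * u' * u + 3 * u'\<^sup>2" "(u' - u) ^ 3 = 0"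
    unfolding assms by (simp_all add: affine_in_osc_line)
  moreover from this(2) have "u' = u" by simp
  moreover from calculation have "v' = v" by algebra
  ultimately show ?thesis by simp
qed

lemma in_g_infinity:
  assumes "p \<noteq> (0 :: 'a::field ^ 4)"
  shows "vec.span {p} \<in> g_infinity \<longleftrightarrow> p $ 0 = 0 \<and> p $ 1 = 0"
proof -
  have eval_Var: "eval_mpoly q (Var i) = q $ i" if "i \<in> {0, 1}" for q :: "'a ^ 4" and i
    unfolding Var_def using that
    by (auto simp: eval_with_single prod_4_from_0 lookup_single when_def)
  have "g_infinity = {vec.span {q} | q. q \<noteq> 0 \<and> q $ 0 = 0 \<and> (q :: 'a ^ 4) $ 1 = 0}"
    unfolding g_infinity_def zero_set_def by (simp add: eval_Var)
  moreover have "p $ 0 = 0 \<and> p $ 1 = 0"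
    if "vec.span {p} = vec.span {q}" "q $ 0 = 0" "q $ 1 = 0" for q
    using span_singleton_eq_imp_scaled[OF that(1) assms] that(2,3)
    by (metis mult_zero_right vector_smult_component)
  ultimately show ?thesis using assms by blast
qed

lemma g_infinity_in_lines: "g_infinity \<in> (lines :: ('a::field ^ 4) set set set)"
proof -
  let ?U = "vec.span {vec4 0 0 1 0, vec4 0 0 0 1 :: 'a ^ 4}"
  have U: "p \<in> ?U \<longleftrightarrow> p $ 0 = 0 \<and> p $ 1 = 0" for p
    unfolding in_span_pair by (auto simp: vec4_eq_iff)
  have "P \<in> g_infinity \<longleftrightarrow> P \<in> pts_of ?U" if "P \<in> points" for P
    using that by (auto simp: points_def in_g_infinity span_in_pts_of U)
  moreover have "g_infinity \<subseteq> points" "pts_of ?U \<subseteq> points"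
    by (auto simp: g_infinity_def zero_set_def points_def pts_of_def)
  ultimately have "g_infinity = pts_of ?U" by blast
  also have "\<dots> \<in> lines"
    by (rule pts_of_span_pair_in_lines) (auto simp: vec4_eq_iff)
  finally show ?thesis .
qed

section \<open>Spread, maximality and covering\<close>

text \<open>The characteristic divides the prime 3, and it is never 1 in a field.\<close>

lemma CHAR_eq_3_iff: "CHAR('a::field) = 3 \<longleftrightarrow> (3 :: 'a) = 0"
proof -
  have "(3 :: 'a) = 0 \<longleftrightarrow> CHAR('a) dvd 3"
    using of_nat_eq_0_iff_char_dvd[of 3, where ?'a = 'a] by simp
  also have "\<dots> \<longleftrightarrow> CHAR('a) = 1 \<or> CHAR('a) = 3"
    using prime_nat_iff[of 3] by auto
  finally show ?thesis by simp
qed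

lemma cube_inject:
  assumes "\<not> (\<exists>w::'a::field. w ^ 3 = 1 \<and> w \<noteq> 1)" "a ^ 3 = (b :: 'a) ^ 3"
  shows "a = b"
proof (cases "b = 0")
  case False
  then have "(a / b) ^ 3 = 1" using assms(2) by (simp add: power_divide)
  then have "a / b = 1" using assms(1) by blast
  then show ?thesis using False by simp
qed (use assms(2) in simp)

text \<open>The set \<open>\<O>\<close> in parametrised form, as justified by
  \<open>proper_osculating_tangents_eq\<close>.\<close>

definition osc_lines :: "('a::field ^ 4) set set set"
  where "osc_lines = insert g_infinity {osc_line u v | u v. True}"

lemma osc_lines_subset: "osc_lines \<subseteq> lines"
  using g_infinity_in_lines osc_line_in_lines by (auto simp: osc_lines_def)

section \<open>Skewness of the lines\<close>

lemma osc_line_eq_of_common_point: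
  assumes "(3 :: 'a::field) \<noteq> 0" "\<not> (\<exists>w::'a. w ^ 3 = 1 \<and> w \<noteq> 1)"
    and P: "P \<in> osc_line u v" "P \<in> osc_line u' (v' :: 'a)"
  shows "osc_line u v = osc_line u' v'"
proof -
  have "P \<in> points" using P(1) by (auto simp: osc_line_def pts_of_def)
  then show ?thesis
  proof (cases rule: point_cases)
    case (affine x y z)
    then have "(u - x) ^ 3 = (u' - x) ^ 3" using P by (simp add: affine_in_osc_line)
    then have "u = u'" using cube_inject[OF assms(2)] by fastforce
    then show ?thesis using P affine by (simp add: affine_in_osc_line)
  next
    case (infinite y z)
    then show ?thesis using P assms(1) by (simp add: infinite_in_osc_line)
  next
    case (on_g_infinity p)
    then show ?thesis using P not_in_osc_line by blast
  qed
qed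

lemma osc_line_disjoint_g_infinity: "osc_line u v \<inter> g_infinity = {}"
proof -
  have "P \<notin> g_infinity" if P: "P \<in> osc_line u v" for P
  proof -
    have "P \<in> points" using P by (auto simp: osc_line_def pts_of_def)
    then obtain p where "p \<noteq> 0" "P = vec.span {p}" by (auto simp: points_def)
    then show ?thesis using P in_g_infinity not_in_osc_line by blast
  qed
  then show ?thesis by blast
qed

lemma partial_spread_osc_lines_iff:
  "partial_spread (osc_lines :: ('a::field ^ 4) set set set) \<longleftrightarrow>
    (3 :: 'a) \<noteq> 0 \<and> \<not> (\<exists>w::'a. w ^ 3 = 1 \<and> w \<noteq> 1)"
proof
  assume spread: "partial_spread (osc_lines :: ('a ^ 4) set set set)"
  have inj: "u = u' \<and> v = v'" if "P \<in> osc_line u v" "P \<in> osc_line u' v'" for P and u v u' v' :: 'a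
  proof -
    have "osc_line u v \<in> osc_lines" "osc_line u' v' \<in> osc_lines" by (auto simp: osc_lines_def)
    then have "osc_line u v = osc_line u' v'"
      using spread that unfolding partial_spread_def by blast
    then show ?thesis by (rule osc_line_inject)
  qed
  have "(3 :: 'a) \<noteq> 0"
  proof
    assume "(3 :: 'a) = 0"
    \<comment> \<open>If \<open>3 = 0\<close>, the point \<open>(0, 1, 3u, v)\<close> does not
      depend on \<open>u\<close>, so lines with equal \<open>v\<close> meet.\<close>
    then have "vec.span {vec4 0 1 0 0} \<in> osc_line 0 (0 :: 'a)"
        "vec.span {vec4 0 1 0 0} \<in> osc_line 1 (0 :: 'a)"
      by (simp_all add: infinite_in_osc_line)
    then show False using inj by fastforce
  qed
  moreover have "w = 1" if "w ^ 3 = 1" for w :: 'a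
  proof -
    \<comment> \<open>At this point \<open>x = y = 0\<close> and \<open>x*y - x^3 - z = 1\<close>,
      so the lines through it correspond to the third roots of unity.\<close>
    have "vec.span {vec4 1 0 0 (- 1)} \<in> osc_line w (3 * w\<^sup>2)"
        "vec.span {vec4 1 0 0 (- 1)} \<in> osc_line 1 (3 :: 'a)"
      using that by (simp_all add: affine_in_osc_line)
    then show ?thesis using inj by blast
  qed
  ultimately show "(3 :: 'a) \<noteq> 0 \<and> \<not> (\<exists>w::'a. w ^ 3 = 1 \<and> w \<noteq> 1)" by blast
next
  assume R: "(3 :: 'a) \<noteq> 0 \<and> \<not> (\<exists>w::'a. w ^ 3 = 1 \<and> w \<noteq> 1)"
  have "l \<inter> m = {}" if lm: "l \<in> osc_lines" "m \<in> osc_lines" "l \<noteq> m" for l m :: "('a ^ 4) set set"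
  proof -
    have "osc_line u v \<inter> osc_line u' v' = {}" if "osc_line u v \<noteq> osc_line u' v'" for u v u' v' :: 'a
      using R osc_line_eq_of_common_point that by blast
    then show ?thesis
      using lm osc_line_disjoint_g_infinity unfolding osc_lines_def by blast
  qed
  then show "partial_spread (osc_lines :: ('a ^ 4) set set set)"
    unfolding partial_spread_def using osc_lines_subset by blast
qed

text \<open>Off \<open>g_infinity\<close>, a point \<open>(0, 1, y, z)\<close> of the plane lies on
  the line with \<open>u = y / 3\<close> and \<open>v = z\<close>.\<close>

lemma osc_lines_cover_plane:
  assumes "(3 :: 'a::field) \<noteq> 0" "p \<noteq> 0" "p $ 0 = (0 :: 'a)"
  shows "\<exists>l\<in>osc_lines. vec.span {p} \<in> l"
proof -
  have "vec.span {p} \<in> points" using assms by (auto simp: points_def)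
  then show ?thesis
  proof (cases rule: point_cases)
    case (affine x y z)
    then obtain c where "c \<noteq> 0" "p = c *s vec4 1 x y z"
      using assms(2) span_singleton_eq_imp_scaled by metis
    then show ?thesis using assms(3) by simp
  next
    case (infinite y z)
    then have "vec.span {p} \<in> osc_line (y / 3) z"
      using assms(1) by (simp add: infinite_in_osc_line)
    then show ?thesis by (auto simp: osc_lines_def)
  next
    case (on_g_infinity r)
    then show ?thesis by (auto simp: osc_lines_def in_g_infinity)
  qed
qed

text \<open>Every line meets the plane \<open>X\<^sub>0 = 0\<close>, all of whose points already lie on a line of the set.\<close>

lemma osc_lines_maximal:
  assumes "(3 :: 'a::field) \<noteq> 0"
  shows "\<not> (\<exists>S. partial_spread S \<and> (osc_lines :: ('a ^ 4) set set set) \<subset> S)"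
proof
  assume "\<exists>S. partial_spread S \<and> (osc_lines :: ('a ^ 4) set set set) \<subset> S"
  then obtain S and l :: "('a ^ 4) set set"
    where S: "partial_spread S" "osc_lines \<subseteq> S" and l: "l \<in> S" "l \<notin> osc_lines"
    by blast
  then have "l \<in> lines" by (auto simp: partial_spread_def)
  then obtain x where x: "x \<noteq> 0" "x $ 0 = 0" "vec.span {x} \<in> l" by (rule line_meets_plane)
  obtain m where m: "m \<in> osc_lines" "vec.span {x} \<in> m"
    using osc_lines_cover_plane[OF assms x(1,2)] by blast
  have "l \<noteq> m" "m \<in> S" using m(1) l(2) S(2) by auto
  then have "l \<inter> m = {}" using S(1) l(1) by (simp add: partial_spread_def)
  then show False using x(3) m(2) by auto
qed

section \<open>Covering of all points\<close>

lemma covering_osc_lines_iff: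
  "covering (osc_lines :: ('a::field ^ 4) set set set) \<longleftrightarrow>
    (3 :: 'a) \<noteq> 0 \<and> (\<forall>a::'a. \<exists>b. b ^ 3 = a)"
proof
  assume cov: "covering (osc_lines :: ('a ^ 4) set set set)"
  have meet: "\<exists>u v. vec.span {p} \<in> osc_line u v" if "p $ 0 \<noteq> 0 \<or> p $ 1 \<noteq> 0" for p :: "'a ^ 4"
  proof -
    have "p \<noteq> 0" using that by auto
    then have "vec.span {p} \<notin> g_infinity" using that by (simp add: in_g_infinity)
    moreover have "vec.span {p} \<in> points" using \<open>p \<noteq> 0\<close> by (auto simp: points_def)
    then obtain l where "l \<in> osc_lines" "vec.span {p} \<in> l"
      using cov unfolding covering_def by blast
    ultimately show ?thesis by (auto simp: osc_lines_def)
  qed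
  \<comment> \<open>A line through \<open>(0, 1, 1, 0)\<close> has \<open>3 * u = 1\<close>.\<close>
  have "(3 :: 'a) \<noteq> 0"
    using meet[of "vec4 0 1 1 0"] by (auto simp: infinite_in_osc_line)
  \<comment> \<open>A line through \<open>(1, 0, 0, -a)\<close> has
    \<open>u ^ 3 = a\<close>.\<close>
  moreover have "\<exists>b. b ^ 3 = a" for a :: 'a
    using meet[of "vec4 1 0 0 (- a)"] by (auto simp: affine_in_osc_line)
  ultimately show "(3 :: 'a) \<noteq> 0 \<and> (\<forall>a::'a. \<exists>b. b ^ 3 = a)" by blast
next
  assume R: "(3 :: 'a) \<noteq> 0 \<and> (\<forall>a::'a. \<exists>b. b ^ 3 = a)"
  have "\<exists>l\<in>osc_lines. P \<in> l" if "P \<in> points" for P :: "('a ^ 4) set"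
    using that
  proof (cases rule: point_cases)
    case (affine x y z)
    obtain b where "b ^ 3 = x * y - x ^ 3 - z" using R by blast
    \<comment> \<open>Solves \<open>u - x = b\<close>; the value of \<open>v\<close> is then forced
      by incidence.\<close>
    then have "P \<in> osc_line (x + b) (y - 3 * (x + b) * x + 3 * (x + b)\<^sup>2)"
      using affine by (simp add: affine_in_osc_line)
    then show ?thesis by (auto simp: osc_lines_def)
  next
    case (infinite y z)
    then show ?thesis using osc_lines_cover_plane[of "vec4 0 1 y z"] R by (auto simp: vec4_eq_iff)
  next
    case (on_g_infinity p)
    then show ?thesis using osc_lines_cover_plane R by blast
  qed
  then show "covering (osc_lines :: ('a ^ 4) set set set)"
    unfolding covering_def using osc_lines_subset by blast
qed

theorem theorem3p3:
  "let \<O> = {t \<in> lines. proper_osculating_tangent t} \<union> {g_infinity :: ('a::field ^ 4) set set} in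
     (partial_spread \<O> \<longleftrightarrow> CHAR('a) \<noteq> 3 \<and> \<not> (\<exists>w::'a. w ^ 3 = 1 \<and> w \<noteq> 1)) \<and>
     (partial_spread \<O> \<longrightarrow> \<not> (\<exists>S. partial_spread S \<and> \<O> \<subset> S)) \<and>
     (covering \<O> \<longleftrightarrow> CHAR('a) \<noteq> 3 \<and> (\<forall>a::'a. \<exists>b. b ^ 3 = a))"
proof -
  have "{t \<in> lines. proper_osculating_tangent t} \<union> {g_infinity :: ('a ^ 4) set set} = osc_lines"
    unfolding osc_lines_def proper_osculating_tangents_eq by simp
  \<comment> \<open>In the maximality claim, \<open>3 \<noteq> 0\<close> comes from the spread
    criterion.\<close>
  then show ?thesis
    using partial_spread_osc_lines_iff osc_lines_maximal covering_osc_lines_iff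
    unfolding Let_def CHAR_eq_3_iff by metis
qed

end
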